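(* Let $X_1,\dots,X_n\in\mathcal{M}(R,M)$ be measures with labels $Z_1,\dots,Z_n\in\{1,\dots,L\}$. Assume that the codebook $\mathbf{c}=(c_1,\dots,c_k)\in\mathcal{B}(0,R)^k$ shatters $X_1,\dots,X_n$ with parameters $(p,r,\Delta)$, where $p\in\mathbb{N}^*$, $r>0$, $\Delta\ge 0$. If $\Psi$ is a $(p,\delta)$-kernel function with $\delta\le \frac{\Delta}{4M}$, then for all $i_1,i_2\in\{1,\dots,n\}$ and all $\sigma\in[r,2r]$, $$Z_{i_1}\neq Z_{i_2}\ \Longrightarrow\ \|v_{\mathbf{c},\sigma}(X_{i_1})-v_{\mathbf{c},\sigma}(X_{i_2})\|_\infty\ \ge\ \frac{\Delta}{2}.$$
   Context: $\mathcal{B}(x,r)$ is the (closed) Euclidean ball of $\mathbb{R}^d$. $\mathcal{M}(R,M)$ is the set of (nonnegative) Borel measures on $\mathcal{B}(0,R)\subset\mathbb{R}^d$ with total mass at most $M$. Kernel functions: for $(p,\delta)\in\mathbb{N}^*\times[0,1/2]$, a function $\psi:\mathbb{R}^+\to\mathbb{R}^+$ is a $(p,\delta)$-kernel function if (i) $\|\psi\|_\infty\le 1$; (ii) $\inf_{0\le u\le 1/p}\psi(u)\ge 1-\delta$; (iii) $\sup_{u>2p}\psi(u)\le\delta$; (iv) $\psi$ is $1$-Lipschitz. Vectorization: for a codebook $\mathbf{c}=(c_1,\dots,c_k)$ and $\sigma>0$, $v_{\mathbf{c},\sigma}(\mu)=\left(\int\Psi(\|u-c_1\|/\sigma)\,\mu(du),\dots,\int\Psi(\|u-c_k\|/\sigma)\,\mu(du)\right)\in[0,M]^k$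 for $\mu\in\mathcal{M}(R,M)$. Shattering: $\mathbf{c}\in\mathcal{B}(0,R)^k$ is said to $(p,r,\Delta)$-shatter $X_1,\dots,X_n$ (with labels $Z_1,\dots,Z_n$) if for any $i_1,i_2$ with $Z_{i_1}\neq Z_{i_2}$ there exists $j\in\{1,\dots,k\}$ such that $X_{i_1}(\mathcal{B}(c_j,r/p))\ge X_{i_2}(\mathcal{B}(c_j,4pr))+\Delta$ or $X_{i_2}(\mathcal{B}(c_j,r/p))\ge X_{i_1}(\mathcal{B}(c_j,4pr))+\Delta$. *)

theory Defs
  imports "HOL-Analysis.Analysis"
begin

text \<open>A Borel measure on the closed ball of radius \<open>R\<close> is represented by its extension by
  zero to the whole space, so that balls not contained in \<open>cball 0 R\<close> can be measured directly.\<close>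

definition ball_measures :: "real \<Rightarrow> real \<Rightarrow> 'a::euclidean_space measure set" where
  "ball_measures R M =
     {\<mu>. sets \<mu> = sets borel \<and> finite_measure \<mu> \<and>
          emeasure \<mu> (- cball 0 R) = 0 \<and> measure \<mu> (space \<mu>) \<le> M}"

text \<open>A function from the nonnegative reals to themselves is a function on the reals of which only
  the values on \<open>{0..}\<close> are constrained or used. The suprema are real-valued, so the sup norm
  bound needs an explicit boundedness condition; then the other supremum is meaningful too, and
  the infimum is by nonnegativity.\<close>

definition kernel_function :: "nat \<Rightarrow> real \<Rightarrow> (real \<Rightarrow> real) \<Rightarrow> bool" where
  "kernel_function p \<delta> \<psi> \<longleftrightarrow>
     1 \<le> p \<and> \<delta> \<in> {0..1/2} \<and>
     (\<forall>u\<ge>0. 0 \<le> \<psi> u) \<and>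
     bdd_above ((\<lambda>u. \<bar>\<psi> u\<bar>) ` {0..}) \<and> (SUP u\<in>{0..}. \<bar>\<psi> u\<bar>) \<le> 1 \<and>
     (INF u\<in>{0..1 / real p}. \<psi> u) \<ge> 1 - \<delta> \<and>
     (SUP u\<in>{2 * real p<..}. \<psi> u) \<le> \<delta> \<and>
     1-lipschitz_on {0..} \<psi>"

text \<open>Codebooks are vectors indexed by a finite type of cardinality \<open>k\<close>, so that
  vectorizations live in a Euclidean space, on which \<^const>\<open>infnorm\<close> is the maximum norm.\<close>

definition vectorize ::
    "(real \<Rightarrow> real) \<Rightarrow> 'a::euclidean_space ^ 'k \<Rightarrow> real \<Rightarrow> 'a measure \<Rightarrow> real ^ 'k" where
  "vectorize \<Psi> c \<sigma> \<mu> = (\<chi> j. \<integral>u. \<Psi> (norm (u - c $ j) / \<sigma>) \<partial>\<mu>)"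

definition shatters ::
    "nat \<Rightarrow> real \<Rightarrow> real \<Rightarrow> 'a::euclidean_space ^ 'k \<Rightarrow>
     nat \<Rightarrow> (nat \<Rightarrow> 'a measure) \<Rightarrow> (nat \<Rightarrow> nat) \<Rightarrow> bool" where
  "shatters p r \<Delta> c n X Z \<longleftrightarrow>
     (\<forall>i1\<in>{1..n}. \<forall>i2\<in>{1..n}. Z i1 \<noteq> Z i2 \<longrightarrow>
        (\<exists>j.
           measure (X i1) (cball (c $ j) (r / real p))
             \<ge> measure (X i2) (cball (c $ j) (4 * real p * r)) + \<Delta> \<or>
           measure (X i2) (cball (c $ j) (r / real p))
             \<ge> measure (X i1) (cball (c $ j) (4 * real p * r)) + \<Delta>))"

end

theory Submission
  imports Defs
begin

text \<open>A kernel evaluated at \<open>norm (u - a) / \<sigma>\<close> is squeezed between two step functions: it is at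
  least \<open>1 - \<delta>\<close> on the ball of radius \<open>\<sigma> / p\<close> around \<open>a\<close>, at most \<open>1\<close> everywhere, and at most \<open>\<delta>\<close>
  off the ball of radius \<open>2 p \<sigma>\<close>. For \<open>\<sigma> \<in> {r..2 * r}\<close> these balls can be replaced by the two balls of
  radii \<open>r / p\<close> and \<open>4 p r\<close> that occur in shattering, the first shrinking and the second growing.
  Integrating (lemmas \<open>integral_kernel_lower\<close> and \<open>integral_kernel_upper\<close>), if \<open>A\<close> is the mass of the
  first measure in the small ball, \<open>B\<close> that of the second in the large ball, and \<open>A \<ge> B + \<Delta>\<close>, then
  the coordinate at the shattering centre separates the two vectorizations by at least
  \<open>(1 - \<delta>) * A - (B + \<delta> * M) = (A - B) - \<delta> * A - \<delta> * M\<close>. Here \<open>A - B \<ge> \<Delta>\<close>, while \<open>A \<le> M\<close> and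
  \<open>\<delta> * M \<le> \<Delta> / 4\<close> bound each of the two error terms by \<open>\<Delta> / 4\<close>.\<close>

lemma
  assumes "kernel_function p \<delta> \<psi>"
  shows kernel_function_delta_nonneg: "0 \<le> \<delta>"
    and kernel_function_nonneg: "\<And>u. 0 \<le> u \<Longrightarrow> 0 \<le> \<psi> u"
    and kernel_function_bdd: "bdd_above ((\<lambda>u. \<bar>\<psi> u\<bar>) ` {0..})"
    and kernel_function_SUP: "(SUP u\<in>{0..}. \<bar>\<psi> u\<bar>) \<le> 1"
    and kernel_function_INF_near: "1 - \<delta> \<le> (INF u\<in>{0..1 / real p}. \<psi> u)"
    and kernel_function_SUP_far: "(SUP u\<in>{2 * real p<..}. \<psi> u) \<le> \<delta>"
    and kernel_function_continuous: "continuous_on {0..} \<psi>"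
proof -
  note parts = assms[unfolded kernel_function_def atLeastAtMost_iff]
  show "0 \<le> \<delta>" "\<And>u. 0 \<le> u \<Longrightarrow> 0 \<le> \<psi> u"
    using parts by blast+
  show "bdd_above ((\<lambda>u. \<bar>\<psi> u\<bar>) ` {0..})"
    using parts by (elim conjE)
  show "(SUP u\<in>{0..}. \<bar>\<psi> u\<bar>) \<le> 1"
    using parts by (elim conjE)
  show "1 - \<delta> \<le> (INF u\<in>{0..1 / real p}. \<psi> u)"
    using parts by (elim conjE)
  show "(SUP u\<in>{2 * real p<..}. \<psi> u) \<le> \<delta>"
    using parts by (elim conjE)
  have "1-lipschitz_on {0..} \<psi>"
    using parts by (elim conjE)
  then show "continuous_on {0..} \<psi>"
    by (rule lipschitz_on_continuous_on)
qed

text \<open>A real-valued supremum or infimum says something about the individual values only for a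
  bounded family. Passing to pointwise bounds therefore relies on nonnegativity for the infimum near
  \<open>0\<close>, and on the bound by \<open>1\<close> for the supremum over large arguments.\<close>

lemma kernel_function_le_1:
  assumes "kernel_function p \<delta> \<psi>" "0 \<le> u"
  shows "\<psi> u \<le> 1"
proof -
  have "\<bar>\<psi> u\<bar> \<le> (SUP u\<in>{0..}. \<bar>\<psi> u\<bar>)"
    by (rule cSUP_upper[OF _ kernel_function_bdd[OF assms(1)]]) (use assms(2) in simp)
  also have "\<dots> \<le> 1"
    by (rule kernel_function_SUP[OF assms(1)])
  finally show ?thesis
    by simp
qed

lemma kernel_function_ge_near:
  assumes "kernel_function p \<delta> \<psi>" "0 \<le> u" "u \<le> 1 / real p"
  shows "1 - \<delta> \<le> \<psi> u"
proof -
  have "bdd_below (\<psi> ` {0..1 / real p})"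
    by (rule bdd_belowI2[where m = 0]) (use kernel_function_nonneg[OF assms(1)] in simp)
  then have "(INF u\<in>{0..1 / real p}. \<psi> u) \<le> \<psi> u"
    by (rule cINF_lower) (use assms(2,3) in simp)
  then show ?thesis
    using kernel_function_INF_near[OF assms(1)] by linarith
qed

lemma kernel_function_le_far:
  assumes "kernel_function p \<delta> \<psi>" "2 * real p < u"
  shows "\<psi> u \<le> \<delta>"
proof -
  have "\<psi> v \<le> 1" if "2 * real p < v" for v
    using that of_nat_0_le_iff[of p, where 'a = real]
    by (intro kernel_function_le_1[OF assms(1)]) linarith
  then have "bdd_above (\<psi> ` {2 * real p<..})"
    by (intro bdd_aboveI2[where M = 1]) simp
  then have "\<psi> u \<le> (SUP u\<in>{2 * real p<..}. \<psi> u)"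
    by (intro cSUP_upper) (use assms(2) in simp)
  then show ?thesis
    using kernel_function_SUP_far[OF assms(1)] by linarith
qed

lemma integrable_kernel:
  fixes \<mu> :: "'a::euclidean_space measure"
  assumes "kernel_function p \<delta> \<psi>" "0 < \<sigma>" "finite_measure \<mu>" "sets \<mu> = sets borel"
  shows "integrable \<mu> (\<lambda>u. \<psi> (norm (u - a) / \<sigma>))"
proof -
  interpret finite_measure \<mu> by fact
  from kernel_function_continuous[OF assms(1)] have "continuous_on UNIV (\<lambda>u. \<psi> (norm (u - a) / \<sigma>))"
    by (rule continuous_on_compose2) (use assms(2) in \<open>auto intro!: continuous_intros\<close>)
  then have "(\<lambda>u. \<psi> (norm (u - a) / \<sigma>)) \<in> borel_measurable \<mu>"
    using assms(4) by (simp add: borel_measurable_continuous_onI cong: measurable_cong_sets)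
  moreover have "norm (\<psi> (norm (u - a) / \<sigma>)) \<le> 1" for u
    using assms(2) kernel_function_nonneg[OF assms(1)] kernel_function_le_1[OF assms(1)] by simp
  ultimately show ?thesis
    by (intro integrable_const_bound[where B = 1]) auto
qed

text \<open>Integration of \<open>\<psi> \<ge> (1 - \<delta>) * indicator\<close>, the indicator being that of any ball inside the
  region where the kernel is close to \<open>1\<close>.\<close>

lemma integral_kernel_lower:
  fixes \<mu> :: "'a::euclidean_space measure"
  assumes ker: "kernel_function p \<delta> \<psi>" and \<sigma>: "0 < \<sigma>"
    and \<mu>: "finite_measure \<mu>" "sets \<mu> = sets borel" and s: "s \<le> \<sigma> / real p"
  shows "(1 - \<delta>) * measure \<mu> (cball a s) \<le> (\<integral>u. \<psi> (norm (u - a) / \<sigma>) \<partial>\<mu>)"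
proof -
  interpret finite_measure \<mu> by fact
  have [measurable]: "cball a s \<in> sets \<mu>" by (simp add: \<mu>)
  have "(1 - \<delta>) * indicator (cball a s) u \<le> \<psi> (norm (u - a) / \<sigma>)" for u
  proof (cases "u \<in> cball a s")
    case True
    then have "norm (u - a) / \<sigma> \<le> 1 / real p"
      using s \<sigma> by (simp add: dist_norm norm_minus_commute field_simps)
    then show ?thesis
      using kernel_function_ge_near[OF ker] \<sigma> True by simp
  next
    case False
    then show ?thesis
      using kernel_function_nonneg[OF ker] \<sigma> by simp
  qed
  then have "(\<integral>u. (1 - \<delta>) * indicator (cball a s) u \<partial>\<mu>) \<le> (\<integral>u. \<psi> (norm (u - a) / \<sigma>) \<partial>\<mu>)"
    by (intro integral_mono integrable_kernel[OF ker \<sigma> \<mu>] integrable_mult_right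
        integrable_real_indicator) (auto simp: less_top[symmetric])
  then show ?thesis
    by (simp add: \<mu>(2) sets_eq_imp_space_eq)
qed

text \<open>Integration of \<open>\<psi> \<le> indicator + \<delta>\<close>, the indicator being that of any ball covering the
  region where the kernel may exceed \<open>\<delta>\<close>.\<close>

lemma integral_kernel_upper:
  fixes \<mu> :: "'a::euclidean_space measure"
  assumes ker: "kernel_function p \<delta> \<psi>" and \<sigma>: "0 < \<sigma>"
    and \<mu>: "finite_measure \<mu>" "sets \<mu> = sets borel" and t: "2 * real p * \<sigma> \<le> t"
  shows "(\<integral>u. \<psi> (norm (u - a) / \<sigma>) \<partial>\<mu>)
    \<le> measure \<mu> (cball a t) + \<delta> * measure \<mu> (space \<mu>)"
proof -
  interpret finite_measure \<mu> by fact
  have [measurable]: "cball a t \<in> sets \<mu>" by (simp add: \<mu>)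
  have "\<psi> (norm (u - a) / \<sigma>) \<le> indicator (cball a t) u + \<delta>" for u
  proof (cases "u \<in> cball a t")
    case True
    have "\<psi> (norm (u - a) / \<sigma>) \<le> 1"
      using \<sigma> by (intro kernel_function_le_1[OF ker]) simp
    then show ?thesis
      using kernel_function_delta_nonneg[OF ker] True by simp
  next
    case False
    then have "2 * real p * \<sigma> < norm (u - a)"
      using t by (simp add: dist_norm norm_minus_commute)
    then have "2 * real p < norm (u - a) / \<sigma>"
      using \<sigma> by (simp add: field_simps)
    then show ?thesis
      using kernel_function_le_far[OF ker] False by simp
  qed
  then have "(\<integral>u. \<psi> (norm (u - a) / \<sigma>) \<partial>\<mu>)
      \<le> (\<integral>u. indicator (cball a t) u + \<delta> \<partial>\<mu>)"
    by (intro integral_mono integrable_kernel[OF ker \<sigma> \<mu>] Bochner_Integration.integrable_add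
        integrable_real_indicator) (auto simp: less_top[symmetric])
  also have "\<dots> = measure \<mu> (cball a t) + \<delta> * measure \<mu> (space \<mu>)"
    by (subst Bochner_Integration.integral_add)
       (auto simp: less_top[symmetric] \<mu>(2) sets_eq_imp_space_eq
         intro!: integrable_real_indicator)
  finally show ?thesis .
qed

lemma integral_kernel_separation:
  fixes \<mu> \<nu> :: "'a::euclidean_space measure"
  assumes ker: "kernel_function p \<delta> \<psi>" and \<sigma>: "0 < r" "\<sigma> \<in> {r..2 * r}"
    and mem: "\<mu> \<in> ball_measures R M" "\<nu> \<in> ball_measures R M"
    and \<Delta>: "0 \<le> \<Delta>" "\<delta> \<le> \<Delta> / (4 * M)"
    and sep: "measure \<mu> (cball a (r / real p)) \<ge> measure \<nu> (cball a (4 * real p * r)) + \<Delta>"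
  shows "(\<integral>u. \<psi> (norm (u - a) / \<sigma>) \<partial>\<mu>) - (\<integral>u. \<psi> (norm (u - a) / \<sigma>) \<partial>\<nu>) \<ge> \<Delta> / 2"
proof -
  define A where "A = measure \<mu> (cball a (r / real p))"
  define B where "B = measure \<nu> (cball a (4 * real p * r))"
  have \<delta>: "0 \<le> \<delta>"
    by (rule kernel_function_delta_nonneg[OF ker])
  from mem have fin: "finite_measure \<mu>" "finite_measure \<nu>"
    and sets: "sets \<mu> = sets borel" "sets \<nu> = sets borel"
    and mass: "measure \<mu> (space \<mu>) \<le> M" "measure \<nu> (space \<nu>) \<le> M"
    by (auto simp: ball_measures_def)
  have "A \<le> M"
    using finite_measure.bounded_measure[OF fin(1)] mass(1) order_trans unfolding A_def by blast
  moreover have "0 \<le> A"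
    by (simp add: A_def)
  ultimately have "0 \<le> M"
    by linarith
  \<comment> \<open>When \<open>M = 0\<close> the quotient \<open>\<Delta> / (4 * M)\<close> is \<open>0\<close>, but the product form below still holds.\<close>
  have \<delta>M: "\<delta> * M \<le> \<Delta> / 4"
    using \<Delta> \<open>0 \<le> M\<close> by (cases "M = 0") (auto simp: field_simps)
  have \<delta>A: "\<delta> * A \<le> \<delta> * M"
    using \<open>A \<le> M\<close> \<delta> by (rule mult_left_mono)
  have "r / real p \<le> \<sigma> / real p"
    using \<sigma>(2) by (intro divide_right_mono) auto
  then have lower: "(1 - \<delta>) * A \<le> (\<integral>u. \<psi> (norm (u - a) / \<sigma>) \<partial>\<mu>)"
    unfolding A_def using \<sigma> by (intro integral_kernel_lower[OF ker _ fin(1) sets(1)]) auto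
  have "2 * real p * \<sigma> \<le> 4 * real p * r"
    using \<sigma>(2) mult_left_mono[of \<sigma> "2 * r" "2 * real p"] by simp
  then have "(\<integral>u. \<psi> (norm (u - a) / \<sigma>) \<partial>\<nu>) \<le> B + \<delta> * measure \<nu> (space \<nu>)"
    unfolding B_def using \<sigma> by (intro integral_kernel_upper[OF ker _ fin(2) sets(2)]) auto
  also have "\<dots> \<le> B + \<delta> * M"
    using mass(2) \<delta> by (intro add_left_mono mult_left_mono) auto
  finally have upper: "(\<integral>u. \<psi> (norm (u - a) / \<sigma>) \<partial>\<nu>) \<le> B + \<delta> * M" .
  have "\<Delta> \<le> A - B"
    using sep unfolding A_def B_def by linarith
  moreover have "(1 - \<delta>) * A = A - \<delta> * A"
    by (simp add: left_diff_distrib)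
  ultimately show ?thesis
    using lower upper \<delta>M \<delta>A by linarith
qed

theorem proposition3:
  fixes X :: "nat \<Rightarrow> 'a::euclidean_space measure"
    and Z :: "nat \<Rightarrow> nat"
    and c :: "'a ^ 'k"
    and \<Psi> :: "real \<Rightarrow> real"
    and n L p :: nat
    and R M r \<Delta> \<delta> :: real
  assumes "\<And>i. i \<in> {1..n} \<Longrightarrow> X i \<in> ball_measures R M"
    and "\<And>i. i \<in> {1..n} \<Longrightarrow> Z i \<in> {1..L}"
    and "\<And>j. c $ j \<in> cball 0 R"
    and "1 \<le> p" and "0 < r" and "0 \<le> \<Delta>"
    and "shatters p r \<Delta> c n X Z"
    and "kernel_function p \<delta> \<Psi>"
    and "\<delta> \<le> \<Delta> / (4 * M)"
  shows "\<forall>i1\<in>{1..n}. \<forall>i2\<in>{1..n}. \<forall>\<sigma>\<in>{r..2 * r}.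
           Z i1 \<noteq> Z i2 \<longrightarrow>
           infnorm (vectorize \<Psi> c \<sigma> (X i1) - vectorize \<Psi> c \<sigma> (X i2)) \<ge> \<Delta> / 2"
proof (intro ballI impI)
  fix i1 i2 \<sigma>
  assume i: "i1 \<in> {1..n}" "i2 \<in> {1..n}" and \<sigma>: "\<sigma> \<in> {r..2 * r}" and "Z i1 \<noteq> Z i2"
  let ?I = "\<lambda>i j. \<integral>u. \<Psi> (norm (u - c $ j) / \<sigma>) \<partial>X i"
  from assms(7) i \<open>Z i1 \<noteq> Z i2\<close> obtain j where
    "measure (X i1) (cball (c $ j) (r / real p))
       \<ge> measure (X i2) (cball (c $ j) (4 * real p * r)) + \<Delta> \<or>
     measure (X i2) (cball (c $ j) (r / real p))
       \<ge> measure (X i1) (cball (c $ j) (4 * real p * r)) + \<Delta>"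
    unfolding shatters_def by blast
  then have "?I i1 j - ?I i2 j \<ge> \<Delta> / 2 \<or> ?I i2 j - ?I i1 j \<ge> \<Delta> / 2"
    using integral_kernel_separation[OF assms(8,5) \<sigma> _ _ assms(6,9)] assms(1) i by blast
  then have "\<Delta> / 2 \<le> \<bar>(vectorize \<Psi> c \<sigma> (X i1) - vectorize \<Psi> c \<sigma> (X i2)) $ j\<bar>"
    unfolding vectorize_def vector_minus_component vec_lambda_beta by linarith
  also have "\<dots> \<le> infnorm (vectorize \<Psi> c \<sigma> (X i1) - vectorize \<Psi> c \<sigma> (X i2))"
    by (rule component_le_infnorm_cart)
  finally show "infnorm (vectorize \<Psi> c \<sigma> (X i1) - vectorize \<Psi> c \<sigma> (X i2)) \<ge> \<Delta> / 2" .
qed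

end
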